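(* Let $n,t\ge1$ be integers, $W\in\mathrm{CLDUI}^{(t)}_n$ and $0\le s\le t$. Then $W^{T_{B[s]}}\succeq0$ if and only if $W^{T_{B[s]}}[C]\succeq0$ for all the maximal cliques $C$ of the graph $G^{(t)}_{n,s}$.
   Context: Matrices in $\mathrm{Herm}(\mathbb C^n\otimes(\mathbb C^n)^{\otimes t})$ are indexed by $[n]^{t+1}$, whose elements are written $i_0\underline i$, $i_0\in[n]$, $\underline i=i_1\ldots i_t\in[n]^t$. $W[C]$ denotes the principal submatrix of $W$ indexed by $C$. $\mathrm{CLDUI}^{(t)}_n$ is the set of $\rho\in\mathrm{Herm}(\mathbb C^n\otimes(\mathbb C^n)^{\otimes t})$ with $\rho=(U\otimes\overline U^{\otimes t})\rho(U\otimes\overline U^{\otimes t})^*$ for all diagonal unitary $n\times n$ matrices $U$. For $0\le s\le t$ the partial transpose is $(\rho^{T_{B[s]}})_{i_0\underline h\,\underline i,\ j_0\underline k\,\underline j}=\rho_{i_0\underline k\,\underline i,\ j_0\underline h\,\underline j}$ ($\underline h,\underline k\in[n]^s$, $\underline i,\underline j\in[n]^{t-s}$). For a finite sequence $\underline i$ over $[n]$, $\alpha(\underline i)\in\mathbb N^n$ has $k$-th entry the number of occurrences of $k$ in $\underline i$. Let $\Omega^{(t)}_n=\{(i_0\underline i,j_0\underline j)\in[n]^{t+1}\times[n]^{t+1}:\alpha(i_0\underline j)=\alpha(j_0\underline i)\}$. Let $T_{B[s]}(i_0\underline i,j_0\underline j)=(i_0j_1\ldots j_si_{s+1}\ldots i_t,\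 j_0i_1\ldots i_sj_{s+1}\ldots j_t)$ and $\Omega^{(t)}_{n,s}=\{(i_0\underline i,j_0\underline j):T_{B[s]}(i_0\underline i,j_0\underline j)\in\Omega^{(t)}_n\}$. $G^{(t)}_{n,s}$ is the undirected graph with vertex set $[n]^{t+1}$ and edge set $\Omega^{(t)}_{n,s}$ (ignoring loops); for $s=0$, $\Omega^{(t)}_{n,0}=\Omega^{(t)}_n$ and $G^{(t)}_{n,0}=G^{(t)}_n=([n]^{t+1},\Omega^{(t)}_n)$. *)

theory Defs
  imports "HOL-Analysis.Analysis" "HOL-Library.Ramsey"
begin

text \<open>
  A complex matrix whose rows and columns are indexed by a finite set \<open>I\<close> is a function of two
  indices together with \<open>I\<close>; only its values on \<open>I \<times> I\<close> matter, so every notion below is relative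
  to \<open>I\<close>.
\<close>

type_synonym 'i cmat = "'i \<Rightarrow> 'i \<Rightarrow> complex"

definition mat_eq_on :: "'i set \<Rightarrow> 'i cmat \<Rightarrow> 'i cmat \<Rightarrow> bool" where
  "mat_eq_on I A B \<longleftrightarrow> (\<forall>x\<in>I. \<forall>y\<in>I. A x y = B x y)"

definition mat_mult :: "'i set \<Rightarrow> 'i cmat \<Rightarrow> 'i cmat \<Rightarrow> 'i cmat" where
  "mat_mult I A B = (\<lambda>x y. \<Sum>z\<in>I. A x z * B z y)"

definition mat_one :: "'i cmat" where
  "mat_one = (\<lambda>x y. if x = y then 1 else 0)"

definition mat_conj :: "'i cmat \<Rightarrow> 'i cmat" where
  "mat_conj A = (\<lambda>x y. cnj (A x y))"

definition mat_adj :: "'i cmat \<Rightarrow> 'i cmat" where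
  "mat_adj A = (\<lambda>x y. cnj (A y x))"

definition hermitian_on :: "'i set \<Rightarrow> 'i cmat \<Rightarrow> bool" where
  "hermitian_on I A \<longleftrightarrow> mat_eq_on I A (mat_adj A)"

definition unitary_on :: "'i set \<Rightarrow> 'i cmat \<Rightarrow> bool" where
  "unitary_on I U \<longleftrightarrow> mat_eq_on I (mat_mult I U (mat_adj U)) mat_one
                  \<and> mat_eq_on I (mat_mult I (mat_adj U) U) mat_one"

definition diagonal_on :: "'i set \<Rightarrow> 'i cmat \<Rightarrow> bool" where
  "diagonal_on I U \<longleftrightarrow> (\<forall>x\<in>I. \<forall>y\<in>I. x \<noteq> y \<longrightarrow> U x y = 0)"

text \<open>The quadratic form of a Hermitian matrix is real, hence the real part.\<close>

definition psd_on :: "'i set \<Rightarrow> 'i cmat \<Rightarrow> bool" where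
  "psd_on I A \<longleftrightarrow> hermitian_on I A
     \<and> (\<forall>v. 0 \<le> Re (\<Sum>x\<in>I. \<Sum>y\<in>I. cnj (v x) * A x y * v y))"

text \<open>\<open>A[C]\<close> has index set \<open>C\<close>; entries outside are \<open>undefined\<close>.\<close>

definition principal_submatrix :: "'i cmat \<Rightarrow> 'i set \<Rightarrow> 'i cmat" where
  "principal_submatrix A C = (\<lambda>x y. if x \<in> C \<and> y \<in> C then A x y else undefined)"

definition kron :: "'i cmat \<Rightarrow> 'j cmat \<Rightarrow> ('i \<times> 'j) cmat" where
  "kron A B = (\<lambda>(a, b) (c, d). A a c * B b d)"

text \<open>The tensor power \<open>A\<^sup>\<otimes>\<^sup>t\<close>, indexed by words of length \<open>t\<close>.\<close>

definition kron_power :: "nat \<Rightarrow> 'i cmat \<Rightarrow> 'i list cmat" where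
  "kron_power t A = (\<lambda>is js. \<Prod>k<t. A (is ! k) (js ! k))"

text \<open>
  An index \<open>i\<^sub>0i\<^sub>1\<dots>i\<^sub>t \<in> [n]\<^sup>t\<^sup>+\<^sup>1\<close>, with \<open>[n] = {1..n}\<close>, is the pair of \<open>i\<^sub>0\<close> and the list
  \<open>[i\<^sub>1, \<dots>, i\<^sub>t]\<close>.
\<close>

type_synonym idx = "nat \<times> nat list"

definition words :: "nat \<Rightarrow> nat \<Rightarrow> nat list set" where
  "words n t = {w. length w = t \<and> set w \<subseteq> {1..n}}"

definition indices :: "nat \<Rightarrow> nat \<Rightarrow> idx set" where
  "indices n t = {1..n} \<times> words n t"

definition CLDUI :: "nat \<Rightarrow> nat \<Rightarrow> idx cmat set" where
  "CLDUI n t = {\<rho>. hermitian_on (indices n t) \<rho> \<and>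
     (\<forall>U. diagonal_on {1..n} U \<and> unitary_on {1..n} U \<longrightarrow>
       (let V = kron U (kron_power t (mat_conj U)) in
        mat_eq_on (indices n t) \<rho>
          (mat_mult (indices n t) (mat_mult (indices n t) V \<rho>) (mat_adj V))))}"

definition partial_transpose :: "nat \<Rightarrow> idx cmat \<Rightarrow> idx cmat" where
  "partial_transpose s \<rho> =
     (\<lambda>(i0, is) (j0, js). \<rho> (i0, take s js @ drop s is) (j0, take s is @ drop s js))"

text \<open>
  The vector of occurrence counts; for words over \<open>[n]\<close> its entries outside \<open>[n]\<close> are all \<open>0\<close>.
\<close>

definition occ :: "nat list \<Rightarrow> nat \<Rightarrow> nat" where
  "occ w = (\<lambda>k. count_list w k)"

definition Omega :: "nat \<Rightarrow> nat \<Rightarrow> (idx \<times> idx) set" where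
  "Omega n t = {((i0, is), (j0, js)) | i0 is j0 js.
     (i0, is) \<in> indices n t \<and> (j0, js) \<in> indices n t \<and> occ (i0 # js) = occ (j0 # is)}"

fun TB :: "nat \<Rightarrow> idx \<times> idx \<Rightarrow> idx \<times> idx" where
  "TB s ((i0, is), (j0, js)) =
     ((i0, take s js @ drop s is), (j0, take s is @ drop s js))"

definition Omega_s :: "nat \<Rightarrow> nat \<Rightarrow> nat \<Rightarrow> (idx \<times> idx) set" where
  "Omega_s n t s = {p \<in> indices n t \<times> indices n t. TB s p \<in> Omega n t}"

text \<open>
  Edges of \<open>G\<close> are two-element sets of vertices; the relation \<open>\<Omega>\<close> is symmetric, so this loses nothing.
\<close>

definition G_edges :: "nat \<Rightarrow> nat \<Rightarrow> nat \<Rightarrow> idx set set" where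
  "G_edges n t s = {{x, y} | x y. (x, y) \<in> Omega_s n t s \<and> x \<noteq> y}"

definition maximal_clique :: "'v set \<Rightarrow> 'v set set \<Rightarrow> 'v set \<Rightarrow> bool" where
  "maximal_clique V E C \<longleftrightarrow> C \<subseteq> V \<and> clique C E \<and>
     (\<forall>D. D \<subseteq> V \<and> clique D E \<and> C \<subseteq> D \<longrightarrow> D = C)"

end

theory Submission
  imports Defs
begin

text \<open>
  Conjugating by the diagonal unitary with a single nontrivial phase at \<open>k\<close> multiplies the entry
  at \<open>(i\<^sub>0i, j\<^sub>0j)\<close> by a power of that phase, with exponent the difference of the numbers of
  occurrences of \<open>k\<close> in \<open>i\<^sub>0j\<close> and \<open>j\<^sub>0i\<close>; so entries outside \<open>\<Omega>\<close> vanish. Moving the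
  counts of the two indices to opposite sides shows that \<open>\<Omega>\<^sub>s\<close> is the kernel of a map on indices,
  hence an equivalence relation. Its classes are maximal cliques of \<open>G\<^sub>s\<close>, and the partially
  transposed matrix is block diagonal with respect to them.
\<close>

lemma psd_on_cong:
  assumes "mat_eq_on I A B"
  shows "psd_on I A \<longleftrightarrow> psd_on I B"
proof -
  have "(\<Sum>x\<in>I. \<Sum>y\<in>I. cnj (v x) * A x y * v y) = (\<Sum>x\<in>I. \<Sum>y\<in>I. cnj (v x) * B x y * v y)" for v
    using assms by (intro sum.cong refl) (simp add: mat_eq_on_def)
  then show ?thesis
    using assms by (simp add: psd_on_def hermitian_on_def mat_eq_on_def mat_adj_def)
qed

text \<open>\<open>psd_on C\<close> reads a matrix only on \<open>C\<close>, where
  \<open>principal_submatrix A C\<close> agrees with \<open>A\<close>.\<close>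

lemma psd_on_principal_submatrix: "psd_on C (principal_submatrix A C) \<longleftrightarrow> psd_on C A"
  by (rule psd_on_cong) (simp add: mat_eq_on_def principal_submatrix_def)

lemma psd_on_subset:
  assumes "finite I" "C \<subseteq> I" "psd_on I A"
  shows "psd_on C A"
  unfolding psd_on_def
proof (intro conjI allI)
  show "hermitian_on C A"
    using assms unfolding psd_on_def hermitian_on_def mat_eq_on_def by blast
  fix v :: "'a \<Rightarrow> complex"
  \<comment> \<open>Extension by zero turns a test vector on \<open>C\<close> into one on
    \<open>I\<close> with the same value of the quadratic form.\<close>
  define w where "w x = (if x \<in> C then v x else 0)" for x
  have "(\<Sum>x\<in>C. \<Sum>y\<in>C. cnj (v x) * A x y * v y) = (\<Sum>x\<in>C. \<Sum>y\<in>C. cnj (w x) * A x y * w y)"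
    by (intro sum.cong refl) (simp add: w_def)
  also have "\<dots> = (\<Sum>x\<in>C. \<Sum>y\<in>I. cnj (w x) * A x y * w y)"
    using assms by (intro sum.cong refl sum.mono_neutral_left) (auto simp: w_def)
  also have "\<dots> = (\<Sum>x\<in>I. \<Sum>y\<in>I. cnj (w x) * A x y * w y)"
    using assms by (intro sum.mono_neutral_left) (auto simp: w_def)
  finally show "0 \<le> Re (\<Sum>x\<in>C. \<Sum>y\<in>C. cnj (v x) * A x y * v y)"
    using assms(3) by (simp add: psd_on_def)
qed

text \<open>The fibres of \<open>f\<close> index the blocks. Terms linking different fibres vanish,
  so the quadratic form is the sum of the forms of the blocks, each nonnegative.\<close>

lemma psd_on_block_diagonal:
  assumes "finite I" "hermitian_on I A"
    and zero: "\<And>x y. x \<in> I \<Longrightarrow> y \<in> I \<Longrightarrow> f x \<noteq> f y \<Longrightarrow> A x y = 0"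
    and blocks: "\<And>x. x \<in> I \<Longrightarrow> psd_on {y \<in> I. f y = f x} A"
  shows "psd_on I A"
  unfolding psd_on_def
proof (intro conjI allI)
  fix v
  let ?g = "\<lambda>x y. cnj (v x) * A x y * v y"
  have row: "(\<Sum>y\<in>I. ?g x y) = (\<Sum>y\<in>{y\<in>I. f y = f x}. ?g x y)" if "x \<in> I" for x
    using assms(1) that by (intro sum.mono_neutral_right) (auto dest: zero[OF that])
  have "(\<Sum>x\<in>I. \<Sum>y\<in>I. ?g x y) = (\<Sum>c\<in>f ` I. \<Sum>x\<in>{x\<in>I. f x = c}. \<Sum>y\<in>I. ?g x y)"
    using assms(1) by (rule sum.image_gen)
  also have "\<dots> = (\<Sum>c\<in>f ` I. \<Sum>x\<in>{x\<in>I. f x = c}. \<Sum>y\<in>{y\<in>I. f y = c}. ?g x y)"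
    by (rule sum.cong[OF refl], rule sum.cong[OF refl]) (auto simp: row)
  finally have "Re (\<Sum>x\<in>I. \<Sum>y\<in>I. ?g x y) =
      (\<Sum>c\<in>f ` I. Re (\<Sum>x\<in>{x\<in>I. f x = c}. \<Sum>y\<in>{y\<in>I. f y = c}. ?g x y))"
    by (simp only: Re_sum)
  also have "\<dots> \<ge> 0"
    by (rule sum_nonneg) (use blocks in \<open>unfold psd_on_def, blast\<close>)
  finally show "0 \<le> Re (\<Sum>x\<in>I. \<Sum>y\<in>I. ?g x y)" .
qed (fact assms(2))

lemma finite_indices: "finite (indices n t)"
proof -
  have "words n t = {w. set w \<subseteq> {1..n} \<and> length w = t}"
    by (auto simp: words_def)
  then show ?thesis
    by (simp add: indices_def finite_lists_length_eq)
qed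

lemma prod_list_single_phase:
  "prod_list (map (\<lambda>j. if j = k then z else 1) w) = (z :: 'a :: comm_monoid_mult) ^ count_list w k"
  by (induction w) auto

text \<open>Two different words of length \<open>t\<close> differ at some position, and the factor
  of the tensor power at that position is an off-diagonal entry, hence zero.\<close>

lemma kron_diagonal:
  assumes "length is = t" "length js = t"
  shows "kron (\<lambda>x y. if x = y then u x else 0)
      (kron_power t (mat_conj (\<lambda>x y. if x = y then u x else 0))) (i, is) (j, js) =
    (if (i, is) = (j, js) then u i * prod_list (map (\<lambda>k. cnj (u k)) is) else 0)"
proof (cases "is = js")
  case True
  then show ?thesis
    using assms by (simp add: kron_def kron_power_def mat_conj_def prod.list_conv_set_nth
        atLeast0LessThan)
next
  case False
  then obtain k where "k < t" "is ! k \<noteq> js ! k"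
    using assms by (auto simp: list_eq_iff_nth_eq)
  then have "kron_power t (mat_conj (\<lambda>x y. if x = y then u x else 0)) is js = 0"
    by (auto simp: kron_power_def mat_conj_def)
  then show ?thesis
    using False by (simp add: kron_def)
qed

text \<open>Each of the two matrix products collapses to its diagonal term.\<close>

lemma mat_mult_diagonal_conjugation:
  assumes "finite I" "x \<in> I" "y \<in> I" and "diagonal_on I V"
  shows "mat_mult I (mat_mult I V A) (mat_adj V) x y = V x x * A x y * cnj (V y y)"
proof -
  have off: "V p q = 0" if "p \<in> I" "q \<in> I - {p}" for p q
    using assms(4) that by (auto simp: diagonal_on_def)
  have "mat_mult I V A x z = V x x * A x z" for z
    using assms(1,2) by (simp add: mat_mult_def sum.remove[of I x] off)
  then have "mat_mult I (mat_mult I V A) (mat_adj V) x y = (\<Sum>z\<in>I. V x x * A x z * cnj (V y z))"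
    by (subst mat_mult_def) (simp add: mat_adj_def)
  also have "\<dots> = V x x * A x y * cnj (V y y)"
    using assms(1,3) by (simp add: sum.remove[of I y] off)
  finally show ?thesis .
qed

lemma CLDUI_entry_eq_0:
  assumes W: "W \<in> CLDUI n t" and x: "(i, is) \<in> indices n t" and y: "(j, js) \<in> indices n t"
    and ne: "occ (i # js) \<noteq> occ (j # is)"
  shows "W (i, is) (j, js) = 0"
proof (rule ccontr)
  assume nz: "W (i, is) (j, js) \<noteq> 0"
  obtain k where k: "occ (i # js) k \<noteq> occ (j # is) k"
    using ne by blast
  define a b where "a = count_list (i # js) k" and "b = count_list (j # is) k"
  have len: "length is = t" "length js = t"
    using x y by (auto simp: indices_def words_def)
  have le: "a \<le> t + 1" "b \<le> t + 1"
    using count_le_length[of "i # js" k] count_le_length[of "j # is" k] len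
    by (auto simp: a_def b_def simp del: count_list.simps)
  \<comment> \<open>On \<open>[0, \<pi>]\<close>, which contains the arguments of \<open>z ^ a\<close> and \<open>z ^ b\<close>, the cosine is injective.\<close>
  define z where "z = cis (pi / real (t + 1))"
  have z: "z * cnj z = 1"
    by (simp add: z_def cis_cnj cis_mult)
  define u where "u j = (if j = k then z else 1)" for j
  define U where "U = (\<lambda>x y. if x = y then u x else 0)"
  define V where "V = kron U (kron_power t (mat_conj U))"
  have u: "u j * cnj (u j) = 1" for j
    using z by (simp add: u_def)
  have "diagonal_on {1..n} U"
    by (simp add: diagonal_on_def U_def)
  moreover have "unitary_on {1..n} U"
  proof -
    have "(\<Sum>l\<in>{1..n}. U p l * cnj (U q l)) = (if p = q then 1 else 0)"
      "(\<Sum>l\<in>{1..n}. cnj (U l p) * U l q) = (if p = q then 1 else 0)"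
      if "p \<in> {1..n}" "q \<in> {1..n}" for p q
      using that u by (simp_all add: U_def if_distrib[of cnj] if_distrib[of "\<lambda>c. c * _"]
          if_distrib[of "\<lambda>c. _ * c"] mult.commute cong: if_cong)
    then show ?thesis
      by (simp add: unitary_on_def mat_eq_on_def mat_mult_def mat_adj_def mat_one_def)
  qed
  ultimately have "W (i, is) (j, js) =
      mat_mult (indices n t) (mat_mult (indices n t) V W) (mat_adj V) (i, is) (j, js)"
    using W x y unfolding CLDUI_def V_def Let_def mat_eq_on_def by blast
  moreover have Veq: "V (p, ps) (q, qs) =
      (if (p, ps) = (q, qs) then u p * prod_list (map (\<lambda>k. cnj (u k)) ps) else 0)"
    if "length ps = t" "length qs = t" for p ps q qs
    unfolding V_def U_def by (rule kron_diagonal[OF that])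
  have "diagonal_on (indices n t) V"
    by (auto simp: diagonal_on_def Veq indices_def words_def)
  \<comment> \<open>Invariance says that the entry of \<open>W\<close> equals itself times this
    scalar; being nonzero, it cancels.\<close>
  ultimately have "V (i, is) (i, is) * cnj (V (j, js) (j, js)) = 1"
    using nz by (simp add: mat_mult_diagonal_conjugation[OF finite_indices x y])
  moreover have "(\<lambda>l. cnj (u l)) = (\<lambda>l. if l = k then cnj z else 1)"
    by (auto simp: u_def)
  ultimately have "u i * cnj z ^ count_list is k * (cnj (u j) * z ^ count_list js k) = 1"
    using len by (simp add: Veq prod_list_single_phase)
  \<comment> \<open>The factor \<open>u i\<close> joins the powers of \<open>z\<close> from
    \<open>js\<close>, and \<open>cnj (u j)\<close> joins those of \<open>cnj z\<close> from
    \<open>is\<close>; this yields the counts in \<open>i # js\<close> and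
    \<open>j # is\<close>.\<close>
  then have "z ^ a * cnj z ^ b = 1"
    by (auto simp: a_def b_def u_def ac_simps split: if_splits)
  then have "z ^ b = z ^ a * (z * cnj z) ^ b"
    by (simp only: power_mult_distrib) (metis mult.left_commute mult.right_neutral)
  then have "z ^ a = z ^ b"
    by (simp add: z)
  then have "Re (cis (real a * (pi / real (t + 1)))) = Re (cis (real b * (pi / real (t + 1))))"
    by (simp only: z_def Complex.DeMoivre)
  then have "cos (real a * (pi / real (t + 1))) = cos (real b * (pi / real (t + 1)))"
    by (simp only: cis.sel)
  moreover have "real m * (pi / real (t + 1)) \<in> {0..pi}" if "m \<le> t + 1" for m
  proof -
    have "real m * pi \<le> real (t + 1) * pi"
      using that by (intro mult_right_mono) auto
    then show ?thesis
      by (simp add: field_simps del: of_nat_add of_nat_Suc)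
  qed
  ultimately have "real a * (pi / real (t + 1)) = real b * (pi / real (t + 1))"
    using le(1) le(2) by (meson atLeastAtMost_iff cos_inj_pi)
  then have "a = b"
    by (subst (asm) mult_cancel_right) simp
  then show False
    using k by (simp add: a_def b_def occ_def)
qed

text \<open>The leading letter and the first \<open>s\<close> letters of the word count positively,
  the remaining letters negatively. The values are integers because these differences can be
  negative.\<close>

definition signed_occ :: "nat \<Rightarrow> idx \<Rightarrow> nat \<Rightarrow> int" where
  "signed_occ s x = (\<lambda>k. int (occ (fst x # take s (snd x)) k) - int (occ (drop s (snd x)) k))"

lemma transpose_in_indices:
  assumes "(i, is) \<in> indices n t" "(j, js) \<in> indices n t"
  shows "(i, take s js @ drop s is) \<in> indices n t"
  using assms set_take_subset[of s js] set_drop_subset[of s "is"]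
  by (auto simp: indices_def words_def)

text \<open>\<open>Omega\<close> joins the leading letter of the row to the word of the column;
  after partial transposition that word is \<open>take s is @ drop s js\<close>. Collecting the
  letters of each original index on one side gives the signed counts.\<close>

lemma occ_transpose_eq_iff:
  "occ (i # take s is @ drop s js) = occ (j # take s js @ drop s is) \<longleftrightarrow>
    signed_occ s (i, is) = signed_occ s (j, js)"
proof -
  have "count_list (i # take s is @ drop s js) k = count_list (j # take s js @ drop s is) k \<longleftrightarrow>
      signed_occ s (i, is) k = signed_occ s (j, js) k" for k
    by (auto simp: signed_occ_def occ_def)
  then show ?thesis
    by (simp add: fun_eq_iff occ_def)
qed

lemma Omega_s_iff:
  assumes "x \<in> indices n t" "y \<in> indices n t"
  shows "(x, y) \<in> Omega_s n t s \<longleftrightarrow> signed_occ s x = signed_occ s y"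
proof -
  obtain i "is" j js where xy: "x = (i, is)" "y = (j, js)"
    by (metis surj_pair)
  have "(x, y) \<in> Omega_s n t s \<longleftrightarrow>
      occ (i # take s is @ drop s js) = occ (j # take s js @ drop s is)"
    using assms transpose_in_indices[of i "is" n t j js s] transpose_in_indices[of j js n t i "is" s]
    by (auto simp: Omega_s_def Omega_def xy)
  then show ?thesis
    by (simp add: xy occ_transpose_eq_iff)
qed

text \<open>The entry is that of \<open>W\<close> at the transposed pair, which lies outside
  \<open>Omega\<close>.\<close>

lemma partial_transpose_eq_0:
  assumes "W \<in> CLDUI n t" "x \<in> indices n t" "y \<in> indices n t"
    and "signed_occ s x \<noteq> signed_occ s y"
  shows "partial_transpose s W x y = 0"
proof -
  obtain i "is" j js where xy: "x = (i, is)" "y = (j, js)"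
    by (metis surj_pair)
  show ?thesis
    using assms unfolding xy partial_transpose_def
    by (auto intro!: CLDUI_entry_eq_0[OF assms(1)] transpose_in_indices simp: occ_transpose_eq_iff)
qed

text \<open>Swapping row and column commutes with exchanging their first \<open>s\<close> letters,
  so the claim is hermiticity of \<open>W\<close> at the transposed pair.\<close>

lemma hermitian_partial_transpose:
  assumes "hermitian_on (indices n t) W"
  shows "hermitian_on (indices n t) (partial_transpose s W)"
  using assms
  by (auto simp: hermitian_on_def mat_eq_on_def mat_adj_def partial_transpose_def
      intro: transpose_in_indices)

text \<open>A clique containing the class contains \<open>x\<close>; each of its other vertices is
  adjacent to \<open>x\<close> and therefore already belongs to the class.\<close>

lemma maximal_clique_signed_occ_class:
  assumes "x \<in> indices n t"
  shows "maximal_clique (indices n t) (G_edges n t s)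
    {y \<in> indices n t. signed_occ s y = signed_occ s x}" (is "maximal_clique _ _ ?C")
  unfolding maximal_clique_def
proof (intro conjI allI impI)
  show "clique ?C (G_edges n t s)"
    unfolding clique_def
  proof (intro ballI impI)
    fix v w assume "v \<in> ?C" "w \<in> ?C" "v \<noteq> w"
    then have "(v, w) \<in> Omega_s n t s"
      by (simp add: Omega_s_iff)
    then show "{v, w} \<in> G_edges n t s"
      using \<open>v \<noteq> w\<close> unfolding G_edges_def by blast
  qed
  fix D
  assume D: "D \<subseteq> indices n t \<and> clique D (G_edges n t s) \<and> ?C \<subseteq> D"
  have "signed_occ s y = signed_occ s x" if "y \<in> D" for y
  proof (cases "y = x")
    case False
    moreover have "x \<in> D"
      using D assms by blast
    ultimately have "{y, x} \<in> G_edges n t s"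
      using D that by (auto simp: clique_def)
    \<comment> \<open>An edge is an unordered pair and so may come from either orientation; both
      give equal signed counts.\<close>
    then have "(y, x) \<in> Omega_s n t s \<or> (x, y) \<in> Omega_s n t s"
      by (auto simp: G_edges_def doubleton_eq_iff)
    then show ?thesis
      using D that assms by (metis Omega_s_iff subsetD)
  qed simp
  then show "D = ?C"
    using D by blast
qed blast

theorem corollary3p8:
  fixes n t s :: nat and W :: "idx cmat"
  assumes "n \<ge> 1" and "t \<ge> 1"
    and "W \<in> CLDUI n t"
    and "s \<le> t"
  shows "psd_on (indices n t) (partial_transpose s W) \<longleftrightarrow>
    (\<forall>C. maximal_clique (indices n t) (G_edges n t s) C \<longrightarrow>
      psd_on C (principal_submatrix (partial_transpose s W) C))"
proof
  assume "psd_on (indices n t) (partial_transpose s W)"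
  then show "\<forall>C. maximal_clique (indices n t) (G_edges n t s) C \<longrightarrow>
      psd_on C (principal_submatrix (partial_transpose s W) C)"
    by (auto simp: psd_on_principal_submatrix maximal_clique_def
        intro: psd_on_subset[OF finite_indices])
next
  assume cliques: "\<forall>C. maximal_clique (indices n t) (G_edges n t s) C \<longrightarrow>
      psd_on C (principal_submatrix (partial_transpose s W) C)"
  show "psd_on (indices n t) (partial_transpose s W)"
  proof (rule psd_on_block_diagonal[where f = "signed_occ s", OF finite_indices])
    show "hermitian_on (indices n t) (partial_transpose s W)"
      using assms(3) by (intro hermitian_partial_transpose) (simp add: CLDUI_def)
  next
    \<comment> \<open>Each diagonal block is indexed by a class of \<open>signed_occ s\<close>, a
      maximal clique, so the assumption on cliques covers it.\<close>
    fix x assume "x \<in> indices n t"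
    then show "psd_on {y \<in> indices n t. signed_occ s y = signed_occ s x} (partial_transpose s W)"
      using cliques maximal_clique_signed_occ_class psd_on_principal_submatrix by blast
  qed (fact partial_transpose_eq_0[OF assms(3)])
qed

end
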